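(* Suppose $f$ is a real univariate polynomial of degree $d=2d_0+1$ or $d=2d_0$, and let $K=\bigcup_{l=1}^m[a_l,b_l]$ with $a_l<b_l$ for $l=1,\dots,m$. Let $f_{min}$, $f_{sos}$, $f_{mom}$ be the optimal values of the problem of minimizing $f$ over $K$, of the SOS relaxation, and of the moment relaxation (the versions for odd or even $d$ respectively, given in the context). Then all the optimal values $f_{min}$, $f_{sos}$, $f_{mom}$ are achieved for each corresponding optimization problem and they are all equal to each other. Suppose $y^*=(y^{( *,1)},\dots,y^{( *,m)})$ is a minimizer of the moment relaxation (odd version when $d=2d_0+1$, even version when $d=2d_0$). Then $$z^*:=y^{( *,1)}+\cdots+y^{( *,m)}$$ must admit a representing measure $\mu^*$ supported in $K$, and each point in the support of $\mu^*$ is a minimizer of $f$ over $K$. If $f$ is not a constant polynomial, then $f$ has at most $2m+\lceil (d-1)/2\rceil$ minimizers over $K$, and the representing measure $\mu^*$ for $z^*$ must be $r$-atomic with $$r\le 2m+\lceil (d-1)/2\rceil .$$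
   Context: Write $f(x)=f_0+f_1x+\cdots+f_dx^d$. $[x]_{k}=(1,x,\dots,x^{k})^T$; $S^N_+$ is the set of $N\times N$ real symmetric positive semidefinite matrices; $X\succeq Y$ means $X-Y$ is positive semidefinite. For $y=(y_0,\dots,y_d)\in\mathbb{R}^{d+1}$, $\langle f,y\rangle=\sum_{i=0}^df_iy_i$, $M_k[y]=(y_{i+j})_{0\le i,j\le k}$, $N_k[y]=(y_{i+j+1})_{0\le i,j\le k}$, and $G_{k}[y]=(y_{i+j+2})_{0\le i,j\le k-1}$ (a $k\times k$ matrix). A vector $y\in\mathbb{R}^{d+1}$ admits a Borel measure $\mu$ on $\mathbb{R}$ as a representing measure if $y_i=\int x^i\,d\mu$ for $i=0,\dots,d$; the support of $\mu$ is the smallest closed set whose complement has $\mu$-measure zero; $\mu$ is supported in $K$ if its support is contained in $K$; $\mu$ is $r$-atomic if its support consists of exactly $r$ points. Case $d=2d_0+1$. SOS relaxation (value $f_{sos}$): maximize $\gamma$ subject to, for every $l=1,\dots,m$, $$f-\gamma=(x-a_l)[x]_{d_0}^TX_l[x]_{d_0}+(b_l-x)[x]_{d_0}^TY_l[x]_{d_0},\quad X_l,Y_l\in S^{d_0+1}_+.$$ Moment relaxation (value $f_{mom}$): minimize $\sum_{l=1}^m\langle f,y^{(l)}\rangle$ over $y^{(l)}\in\mathbb{R}^{2d_0+2}$, $l=1,\dots,m$, subject to $\sum_{l=1}^my^{(l)}_0=1$ and $b_lM_{d_0}[y^{(l)}]\succeq N_{d_0}[y^{(l)}]\succeq a_lM_{d_0}[y^{(l)}]$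 for every $l$. Case $d=2d_0$. SOS relaxation (value $f_{sos}$): maximize $\gamma$ subject to, for every $l=1,\dots,m$, $$f-\gamma=[x]_{d_0}^TX_l[x]_{d_0}+(x-a_l)(b_l-x)\,[x]_{d_0-1}^TY_l[x]_{d_0-1},\quad X_l\in S^{d_0+1}_+,\ Y_l\in S^{d_0}_+.$$ Moment relaxation (value $f_{mom}$): minimize $\sum_{l=1}^m\langle f,y^{(l)}\rangle$ over $y^{(l)}\in\mathbb{R}^{2d_0+1}$, $l=1,\dots,m$, subject to $\sum_{l=1}^my^{(l)}_0=1$, $M_{d_0}[y^{(l)}]\succeq 0$ and $(a_l+b_l)N_{d_0-1}[y^{(l)}]\succeq a_lb_lM_{d_0-1}[y^{(l)}]+G_{d_0}[y^{(l)}]$ for every $l$. (For $d_0=0$ the empty matrices and the corresponding terms and constraints are omitted.) In the SOS relaxations the scalar $\gamma$ is common to all $l$ and the identities are identities of polynomials in $x$. *)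

theory Defs
  imports
    "HOL-Analysis.Analysis"
    "HOL-Computational_Algebra.Polynomial"
    "Jordan_Normal_Form.Matrix"
begin

(* Vectors and matrices of variable size are those of Jordan_Normal_Form. *)
unbundle no vec_syntax

hide_const (open) Finite_Cartesian_Product.vec Finite_Cartesian_Product.mat

section \<open>Positive semidefinite matrices\<close>

definition psd_mats :: "nat \<Rightarrow> real mat set" where
  "psd_mats n = {A \<in> carrier_mat n n. transpose_mat A = A \<and>
     (\<forall>v \<in> carrier_vec n. 0 \<le> scalar_prod v (A *\<^sub>v v))}"

definition loewner_ge :: "nat \<Rightarrow> real mat \<Rightarrow> real mat \<Rightarrow> bool" where
  "loewner_ge n A B \<longleftrightarrow> A - B \<in> psd_mats n"

section \<open>Polynomials and moment vectors\<close>

text \<open>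
  All matrices are indexed by their number of rows, which is one more than the index \<open>k\<close> in
  \<open>[x]\<^sub>k\<close>, \<open>M\<^sub>k\<close>, \<open>N\<^sub>k\<close>; thus \<open>[x]\<^sub>k = monomials (k + 1)\<close>.
  In this way the terms of index \<open>d\<^sub>0 - 1\<close> are genuinely empty for \<open>d\<^sub>0 = 0\<close>:
  the quadratic forms are then \<open>0\<close> and the matrix inequalities hold trivially.
\<close>

definition monomials :: "nat \<Rightarrow> real poly vec" where
  "monomials n = Matrix.vec n (\<lambda>i. monom 1 i)"

text \<open>The polynomial \<open>[x]\<^sup>T A [x]\<close>; the entries of \<open>A\<close> are read as constant polynomials.\<close>

definition gram_poly :: "nat \<Rightarrow> real mat \<Rightarrow> real poly" where
  "gram_poly n A = scalar_prod (monomials n) (map_mat (\<lambda>c. [:c:]) A *\<^sub>v monomials n)"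

text \<open>
  \<open>M\<^sub>k[y] = hankel 0 (k + 1) y\<close>, \<open>N\<^sub>k[y] = hankel 1 (k + 1) y\<close> and \<open>G\<^sub>k[y] = hankel 2 k y\<close>.
\<close>

definition hankel :: "nat \<Rightarrow> nat \<Rightarrow> real vec \<Rightarrow> real mat" where
  "hankel s n y = Matrix.mat n n (\<lambda>(i, j). y $ (i + j + s))"

definition pairing :: "real poly \<Rightarrow> real vec \<Rightarrow> real" where
  "pairing f y = (\<Sum>i < dim_vec y. coeff f i * y $ i)"

section \<open>The three optimization problems\<close>

definition intervals_union :: "nat \<Rightarrow> (nat \<Rightarrow> real) \<Rightarrow> (nat \<Rightarrow> real) \<Rightarrow> real set" where
  "intervals_union m a b = (\<Union>l \<in> {1..m}. {a l..b l})"

text \<open>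
  Families indexed by \<open>l = 1, \<dots>, m\<close> are functions on \<open>nat\<close>, of which only the values on
  \<open>{1..m}\<close> matter. Optimal values are taken in the extended reals, so that they do not
  presuppose feasibility or boundedness.
\<close>

definition f_min :: "real poly \<Rightarrow> nat \<Rightarrow> (nat \<Rightarrow> real) \<Rightarrow> (nat \<Rightarrow> real) \<Rightarrow> ereal" where
  "f_min f m a b = (INF x \<in> intervals_union m a b. ereal (poly f x))"

definition sos_feasible_odd ::
  "real poly \<Rightarrow> nat \<Rightarrow> (nat \<Rightarrow> real) \<Rightarrow> (nat \<Rightarrow> real) \<Rightarrow> nat \<Rightarrow>
   real \<Rightarrow> (nat \<Rightarrow> real mat) \<Rightarrow> (nat \<Rightarrow> real mat) \<Rightarrow> bool" where
  "sos_feasible_odd f m a b d0 \<gamma> X Y \<longleftrightarrow>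
     (\<forall>l \<in> {1..m}. X l \<in> psd_mats (d0 + 1) \<and> Y l \<in> psd_mats (d0 + 1) \<and>
        f - [:\<gamma>:] = [:- a l, 1:] * gram_poly (d0 + 1) (X l)
                   + [:b l, - 1:] * gram_poly (d0 + 1) (Y l))"

definition sos_feasible_even ::
  "real poly \<Rightarrow> nat \<Rightarrow> (nat \<Rightarrow> real) \<Rightarrow> (nat \<Rightarrow> real) \<Rightarrow> nat \<Rightarrow>
   real \<Rightarrow> (nat \<Rightarrow> real mat) \<Rightarrow> (nat \<Rightarrow> real mat) \<Rightarrow> bool" where
  "sos_feasible_even f m a b d0 \<gamma> X Y \<longleftrightarrow>
     (\<forall>l \<in> {1..m}. X l \<in> psd_mats (d0 + 1) \<and> Y l \<in> psd_mats d0 \<and>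
        f - [:\<gamma>:] = gram_poly (d0 + 1) (X l)
                   + [:- a l, 1:] * [:b l, - 1:] * gram_poly d0 (Y l))"

definition sos_feasible ::
  "real poly \<Rightarrow> nat \<Rightarrow> (nat \<Rightarrow> real) \<Rightarrow> (nat \<Rightarrow> real) \<Rightarrow> nat \<Rightarrow>
   real \<Rightarrow> (nat \<Rightarrow> real mat) \<Rightarrow> (nat \<Rightarrow> real mat) \<Rightarrow> bool" where
  "sos_feasible f m a b d =
     (if odd d then sos_feasible_odd f m a b (d div 2) else sos_feasible_even f m a b (d div 2))"

definition f_sos :: "real poly \<Rightarrow> nat \<Rightarrow> (nat \<Rightarrow> real) \<Rightarrow> (nat \<Rightarrow> real) \<Rightarrow> nat \<Rightarrow> ereal" where
  "f_sos f m a b d = Sup {ereal \<gamma> | \<gamma> X Y. sos_feasible f m a b d \<gamma> X Y}"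

definition mom_feasible_odd ::
  "nat \<Rightarrow> (nat \<Rightarrow> real) \<Rightarrow> (nat \<Rightarrow> real) \<Rightarrow> nat \<Rightarrow> (nat \<Rightarrow> real vec) \<Rightarrow> bool" where
  "mom_feasible_odd m a b d0 y \<longleftrightarrow>
     (\<forall>l \<in> {1..m}. y l \<in> carrier_vec (2 * d0 + 2)) \<and>
     (\<Sum>l = 1..m. y l $ 0) = 1 \<and>
     (\<forall>l \<in> {1..m}.
        loewner_ge (d0 + 1) (b l \<cdot>\<^sub>m hankel 0 (d0 + 1) (y l)) (hankel 1 (d0 + 1) (y l)) \<and>
        loewner_ge (d0 + 1) (hankel 1 (d0 + 1) (y l)) (a l \<cdot>\<^sub>m hankel 0 (d0 + 1) (y l)))"

definition mom_feasible_even ::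
  "nat \<Rightarrow> (nat \<Rightarrow> real) \<Rightarrow> (nat \<Rightarrow> real) \<Rightarrow> nat \<Rightarrow> (nat \<Rightarrow> real vec) \<Rightarrow> bool" where
  "mom_feasible_even m a b d0 y \<longleftrightarrow>
     (\<forall>l \<in> {1..m}. y l \<in> carrier_vec (2 * d0 + 1)) \<and>
     (\<Sum>l = 1..m. y l $ 0) = 1 \<and>
     (\<forall>l \<in> {1..m}.
        hankel 0 (d0 + 1) (y l) \<in> psd_mats (d0 + 1) \<and>
        loewner_ge d0 ((a l + b l) \<cdot>\<^sub>m hankel 1 d0 (y l))
          ((a l * b l) \<cdot>\<^sub>m hankel 0 d0 (y l) + hankel 2 d0 (y l)))"

definition mom_feasible ::
  "nat \<Rightarrow> (nat \<Rightarrow> real) \<Rightarrow> (nat \<Rightarrow> real) \<Rightarrow> nat \<Rightarrow> (nat \<Rightarrow> real vec) \<Rightarrow> bool" where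
  "mom_feasible m a b d =
     (if odd d then mom_feasible_odd m a b (d div 2) else mom_feasible_even m a b (d div 2))"

definition mom_objective :: "real poly \<Rightarrow> nat \<Rightarrow> (nat \<Rightarrow> real vec) \<Rightarrow> real" where
  "mom_objective f m y = (\<Sum>l = 1..m. pairing f (y l))"

definition f_mom :: "real poly \<Rightarrow> nat \<Rightarrow> (nat \<Rightarrow> real) \<Rightarrow> (nat \<Rightarrow> real) \<Rightarrow> nat \<Rightarrow> ereal" where
  "f_mom f m a b d = (INF y \<in> {y. mom_feasible m a b d y}. ereal (mom_objective f m y))"

definition vec_family_sum :: "nat \<Rightarrow> nat \<Rightarrow> (nat \<Rightarrow> real vec) \<Rightarrow> real vec" where
  "vec_family_sum n m y = Matrix.vec n (\<lambda>i. \<Sum>l = 1..m. y l $ i)"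

definition minimizers :: "real poly \<Rightarrow> real set \<Rightarrow> real set" where
  "minimizers f K = {x. is_arg_min (poly f) (\<lambda>x. x \<in> K) x}"

section \<open>Representing measures\<close>

definition representing_measure :: "real measure \<Rightarrow> real vec \<Rightarrow> bool" where
  "representing_measure \<mu> y \<longleftrightarrow> sets \<mu> = sets borel \<and>
     (\<forall>i < dim_vec y. has_bochner_integral \<mu> (\<lambda>x. x ^ i) (y $ i))"

definition measure_support :: "real measure \<Rightarrow> real set" where
  "measure_support \<mu> = \<Inter> {C. closed C \<and> emeasure \<mu> (- C) = 0}"

text \<open>The intersection is indeed the smallest closed set with null complement.\<close>

lemma closed_measure_support: "closed (measure_support \<mu>)"
  unfolding measure_support_def by (rule closed_Inter) auto

lemma emeasure_measure_support:
  assumes "sets \<mu> = sets borel"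
  shows "emeasure \<mu> (- measure_support \<mu>) = 0"
proof -
  let ?U = "uminus ` {C. closed C \<and> emeasure \<mu> (- C) = 0}"
  have "\<And>S. S \<in> ?U \<Longrightarrow> open S"
    by auto
  then obtain V where V: "V \<subseteq> ?U" "countable V" "\<Union> V = \<Union> ?U"
    by (rule Lindelof)
  have "- measure_support \<mu> = \<Union> V"
    unfolding V(3) measure_support_def by auto
  moreover have "(\<Union>S \<in> V. S) \<in> null_sets \<mu>"
  proof (rule null_sets_UN')
    fix S assume "S \<in> V"
    then obtain C where C: "S = - C" "closed C" "emeasure \<mu> (- C) = 0"
      using V(1) by auto
    then have "S \<in> sets \<mu>"
      unfolding assms by auto
    then show "S \<in> null_sets \<mu>"
      using C by (auto simp: null_sets_def)
  qed (fact V(2))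
  ultimately show ?thesis
    by (simp add: null_sets_def)
qed

lemma measure_support_least:
  "closed C \<Longrightarrow> emeasure \<mu> (- C) = 0 \<Longrightarrow> measure_support \<mu> \<subseteq> C"
  unfolding measure_support_def by blast

definition atomic_measure :: "nat \<Rightarrow> real measure \<Rightarrow> bool" where
  "atomic_measure r \<mu> \<longleftrightarrow> finite (measure_support \<mu>) \<and> card (measure_support \<mu>) = r"

end

theory Submission
  imports Defs
begin

text \<open>
  Let \<open>v\<close> be the minimum of \<open>f\<close> over the compact set \<open>K\<close> and \<open>p = f - v\<close>. Then \<open>p\<close> is nonnegative
  on each interval, and the Markov--Lukacs theorem \<open>interval_cert_if_nonneg\<close> writes it there as a
  weighted sum of squares within the degrees that the relaxation admits. So \<open>\<gamma> = v\<close> is feasible for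
  the sum-of-squares relaxation, and it is optimal because a certificate for \<open>\<gamma>\<close> forces \<open>\<gamma> \<le> f\<close> on
  \<open>K\<close>. The matrix inequalities of the moment relaxation say that a block is nonnegative on weighted
  squares (\<open>localizing_psd_iff\<close>). By the same theorem the sum \<open>z\<close> of the blocks is then nonnegative
  on all polynomials of degree at most \<open>d\<close> that are nonnegative on \<open>K\<close>. Applied to \<open>p\<close> this bounds
  the objective from below by \<open>v\<close>, and the point evaluation at a minimizer attains \<open>v\<close>.

  For an optimal \<open>y\<close> the functional \<open>z\<close> annihilates \<open>p\<close>. Since a multiple of \<open>p\<close> can be added for
  free to make a polynomial nonnegative away from the zeros of \<open>p\<close>, the functional depends only on
  the values at these zeros, and monotonically so (\<open>pairing_nonneg_if_nonneg_on_zeros\<close>). If \<open>f\<close> is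
  not constant, the zeros are finitely many, and Lagrange interpolation at them exhibits \<open>z\<close> as a
  nonnegative combination of point evaluations (\<open>pairing_eq_sum_over_zeros\<close>), hence as the moments
  of an atomic measure. Conversely, any representing measure on \<open>K\<close> integrates \<open>p\<close> to \<open>0\<close> and so
  lives on the zeros of \<open>p\<close>, that is, on the minimizers. Their number is bounded since a minimizer
  inside an interval is a multiple root of \<open>p\<close> (\<open>card_zeros_of_nonneg\<close>).
\<close>

section \<open>Certificates of nonnegativity on an interval\<close>

text \<open>
  The strict bound makes \<open>n\<close> the size of a Gram matrix; for \<open>n = 0\<close> only the empty sum
  remains, in accordance with the empty matrix.
\<close>

definition sos :: "nat \<Rightarrow> real poly \<Rightarrow> bool" where
  "sos n p \<longleftrightarrow> (\<exists>qs. (\<forall>q \<in> set qs. degree q < n) \<and> p = (\<Sum>q \<leftarrow> qs. q\<^sup>2))"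

lemma sos_square_mult:
  assumes "sos n s" and "degree r \<le> e"
  shows "sos (n + e) (r\<^sup>2 * s)"
proof -
  obtain qs where qs: "\<forall>q \<in> set qs. degree q < n" "s = (\<Sum>q \<leftarrow> qs. q\<^sup>2)"
    using assms(1) unfolding sos_def by blast
  have "degree (r * q) < n + e" if "q \<in> set qs" for q
    using degree_mult_le[of r q] qs(1) that assms(2) by fastforce
  then have "\<forall>q \<in> set (map ((*) r) qs). degree q < n + e"
    by auto
  moreover have "r\<^sup>2 * s = (\<Sum>q \<leftarrow> map ((*) r) qs. q\<^sup>2)"
    by (simp add: qs(2) sum_list_const_mult o_def power_mult_distrib)
  ultimately show ?thesis
    unfolding sos_def by blast
qed

lemma sos_add_const:
  assumes "sos n s" and "0 \<le> c" and "0 < n"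
  shows "sos n (s + [:c:])"
proof -
  obtain qs where qs: "\<forall>q \<in> set qs. degree q < n" "s = (\<Sum>q \<leftarrow> qs. q\<^sup>2)"
    using assms(1) unfolding sos_def by blast
  have "s + [:c:] = (\<Sum>q \<leftarrow> [:sqrt c:] # qs. q\<^sup>2)"
    using assms(2) by (simp add: qs(2) power2_eq_square)
  moreover have "\<forall>q \<in> set ([:sqrt c:] # qs). degree q < n"
    using qs(1) assms(3) by simp
  ultimately show ?thesis
    unfolding sos_def by blast
qed

lemma sos_0: "sos n 0"
  unfolding sos_def by (rule exI[of _ "[]"]) simp

text \<open>
  The certificate that the sum-of-squares relaxation asks for on a single interval, with sums of
  squares in place of Gram matrices.
\<close>

definition interval_cert :: "real \<Rightarrow> real \<Rightarrow> nat \<Rightarrow> real poly \<Rightarrow> bool" where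
  "interval_cert a b d p \<longleftrightarrow>
     (if odd d
      then \<exists>s t. sos (d div 2 + 1) s \<and> sos (d div 2 + 1) t \<and> p = [:- a, 1:] * s + [:b, - 1:] * t
      else \<exists>s t. sos (d div 2 + 1) s \<and> sos (d div 2) t \<and> p = s + [:- a, 1:] * [:b, - 1:] * t)"

lemma interval_cert_even_iff:
  "interval_cert a b (2 * k) p \<longleftrightarrow>
     (\<exists>s t. sos (Suc k) s \<and> sos k t \<and> p = s + [:- a, 1:] * [:b, - 1:] * t)"
  unfolding interval_cert_def by (simp del: mult_pCons_left mult_pCons_right)

lemma interval_cert_odd_iff:
  "interval_cert a b (Suc (2 * k)) p \<longleftrightarrow>
     (\<exists>s t. sos (Suc k) s \<and> sos (Suc k) t \<and> p = [:- a, 1:] * s + [:b, - 1:] * t)"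
  unfolding interval_cert_def by (simp del: mult_pCons_left mult_pCons_right)

lemma sos_square_linear_mult: "sos k s \<Longrightarrow> sos (Suc k) ([:c, e:]\<^sup>2 * s)"
  using sos_square_mult[of k s "[:c, e:]" 1] by (simp del: mult_pCons_left mult_pCons_right)

text \<open>
  Multiplying by \<open>u = x - a\<close> or \<open>v = b - x\<close> exchanges the two shapes of a certificate: the factor
  either completes a mixed product \<open>u v\<close>, or meets itself and then \<open>u\<^sup>2\<close> or \<open>v\<^sup>2\<close> is absorbed by a
  sum of squares.
\<close>

lemma interval_cert_mult_endpoint:
  assumes "interval_cert a b n q"
  shows "interval_cert a b (Suc n) ([:- a, 1:] * q)" (is "interval_cert a b _ (?u * q)")
    and "interval_cert a b (Suc n) ([:b, - 1:] * q)" (is "interval_cert a b _ (?v * q)")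
proof -
  consider k where "n = 2 * k" | k where "n = Suc (2 * k)"
    by (metis evenE oddE Suc_eq_plus1)
  then have "interval_cert a b (Suc n) (?u * q) \<and> interval_cert a b (Suc n) (?v * q)"
  proof cases
    case (1 k)
    then obtain s t where st: "sos (Suc k) s" "sos k t" "q = s + ?u * ?v * t"
      using assms(1) unfolding 1 interval_cert_even_iff by blast
    have "?u * q = ?u * s + ?v * (?u\<^sup>2 * t)" "?v * q = ?u * (?v\<^sup>2 * t) + ?v * s"
      unfolding st(3) power2_eq_square by (simp_all only: distrib_left ac_simps)
    then show ?thesis
      unfolding 1 interval_cert_odd_iff
      using st(1) sos_square_linear_mult[OF st(2), of "- a" 1]
        sos_square_linear_mult[OF st(2), of b "- 1"] by blast
  next
    case (2 k)
    then obtain s t where st: "sos (Suc k) s" "sos (Suc k) t" "q = ?u * s + ?v * t"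
      using assms(1) unfolding 2 interval_cert_odd_iff by blast
    have "?u * q = ?u\<^sup>2 * s + ?u * ?v * t" "?v * q = ?v\<^sup>2 * t + ?u * ?v * s"
      unfolding st(3) power2_eq_square by (simp_all only: distrib_left ac_simps)
    moreover have n_eq: "Suc n = 2 * Suc k"
      using 2 by simp
    ultimately show ?thesis
      unfolding n_eq interval_cert_even_iff
      using st(1,2) sos_square_linear_mult[OF st(1), of "- a" 1]
        sos_square_linear_mult[OF st(2), of b "- 1"] by blast
  qed
  then show "interval_cert a b (Suc n) (?u * q)" "interval_cert a b (Suc n) (?v * q)"
    by blast+
qed

lemma interval_cert_mult_square:
  assumes "interval_cert a b n q"
  shows "interval_cert a b (Suc (Suc n)) ([:- r, 1:]\<^sup>2 * q)" (is "interval_cert a b _ (?w\<^sup>2 * q)")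
proof -
  let ?u = "[:- a, 1:]" and ?v = "[:b, - 1:]"
  consider k where "n = 2 * k" | k where "n = Suc (2 * k)"
    by (metis evenE oddE Suc_eq_plus1)
  then show ?thesis
  proof cases
    case (1 k)
    then obtain s t where st: "sos (Suc k) s" "sos k t" "q = s + ?u * ?v * t"
      using assms(1) unfolding 1 interval_cert_even_iff by blast
    have "?w\<^sup>2 * q = ?w\<^sup>2 * s + ?u * ?v * (?w\<^sup>2 * t)"
      unfolding st(3) by (simp only: distrib_left mult.left_commute mult.assoc)
    moreover have n_eq: "Suc (Suc n) = 2 * Suc k"
      using 1 by simp
    ultimately show ?thesis
      unfolding n_eq interval_cert_even_iff
      using sos_square_linear_mult[OF st(1), of "- r" 1]
        sos_square_linear_mult[OF st(2), of "- r" 1] by blast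
  next
    case (2 k)
    then obtain s t where st: "sos (Suc k) s" "sos (Suc k) t" "q = ?u * s + ?v * t"
      using assms(1) unfolding 2 interval_cert_odd_iff by blast
    have "?w\<^sup>2 * q = ?u * (?w\<^sup>2 * s) + ?v * (?w\<^sup>2 * t)"
      unfolding st(3) by (simp only: distrib_left mult.left_commute mult.assoc)
    moreover have n_eq: "Suc (Suc n) = Suc (2 * Suc k)"
      using 2 by simp
    ultimately show ?thesis
      unfolding n_eq interval_cert_odd_iff
      using sos_square_linear_mult[OF st(1), of "- r" 1]
        sos_square_linear_mult[OF st(2), of "- r" 1] by blast
  qed
qed

text \<open>
  In odd degree a constant \<open>c\<close> is not a square times a weight, but \<open>(x - a) + (b - x) = b - a\<close>
  lets it be split between both weights.
\<close>

lemma interval_cert_add_const: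
  assumes "interval_cert a b n q" and "a < b" and "0 \<le> c"
  shows "interval_cert a b n (q + [:c:])"
proof -
  let ?u = "[:- a, 1:]" and ?v = "[:b, - 1:]"
  consider k where "n = 2 * k" | k where "n = Suc (2 * k)"
    by (metis evenE oddE Suc_eq_plus1)
  then show ?thesis
  proof cases
    case (1 k)
    then obtain s t where st: "sos (Suc k) s" "sos k t" "q = s + ?u * ?v * t"
      using assms(1) unfolding 1 interval_cert_even_iff by blast
    have "q + [:c:] = (s + [:c:]) + ?u * ?v * t"
      unfolding st(3) by (simp only: ac_simps)
    then show ?thesis
      unfolding 1 interval_cert_even_iff
      using sos_add_const[OF st(1) assms(3)] st(2) by blast
  next
    case (2 k)
    then obtain s t where st: "sos (Suc k) s" "sos (Suc k) t" "q = ?u * s + ?v * t"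
      using assms(1) unfolding 2 interval_cert_odd_iff by blast
    define e where "e = c / (b - a)"
    have "0 \<le> e" "(b - a) * e = c"
      using assms by (simp_all add: e_def)
    then have c_eq: "[:c:] = ?u * [:e:] + ?v * [:e:]"
      by (simp add: algebra_simps)
    have "q + [:c:] = ?u * (s + [:e:]) + ?v * (t + [:e:])"
      unfolding st(3) c_eq by (simp only: distrib_left distrib_right ac_simps)
    then show ?thesis
      unfolding 2 interval_cert_odd_iff
      using sos_add_const[OF st(1) \<open>0 \<le> e\<close>] sos_add_const[OF st(2) \<open>0 \<le> e\<close>] by blast
  qed
qed

lemma interval_cert_0: "interval_cert a b n 0"
proof -
  consider k where "n = 2 * k" | k where "n = Suc (2 * k)"
    by (metis evenE oddE Suc_eq_plus1)
  then show ?thesis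
  proof cases
    case (1 k)
    show ?thesis
      unfolding 1 interval_cert_even_iff by (intro exI[of _ 0] conjI sos_0) simp
  next
    case (2 k)
    show ?thesis
      unfolding 2 interval_cert_odd_iff by (intro exI[of _ 0] conjI sos_0) simp
  qed
qed

lemma poly_attains_min:
  fixes p :: "real poly"
  assumes "compact W" and "W \<noteq> {}"
  obtains w where "w \<in> W" "\<And>x. x \<in> W \<Longrightarrow> poly p w \<le> poly p x"
proof -
  have "continuous_on W (poly p)"
    by (intro continuous_intros)
  from continuous_attains_inf[OF assms this] show ?thesis
    using that by blast
qed

text \<open>
  By continuity. This transfers nonnegativity to a cofactor after division by a factor that
  vanishes at \<open>r\<close>.
\<close>

lemma poly_nonneg_except_point:
  fixes q :: "real poly"
  assumes "a < b" and nonneg: "\<And>x. x \<in> {a..b} \<Longrightarrow> x \<noteq> r \<Longrightarrow> 0 \<le> poly q x"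
    and "x \<in> {a..b}"
  shows "0 \<le> poly q x"
proof (rule ccontr)
  assume neg: "\<not> 0 \<le> poly q x"
  then have "x = r"
    using nonneg assms(3) by blast
  have "isCont (poly q) r"
    by simp
  moreover have "0 < - poly q r"
    using neg \<open>x = r\<close> by simp
  ultimately obtain \<delta> where \<delta>: "\<delta> > 0" "\<And>x'. \<bar>x' - r\<bar> < \<delta> \<Longrightarrow> \<bar>poly q x' - poly q r\<bar> < - poly q r"
    unfolding continuous_at_eps_delta dist_real_def by blast
  define e where "e = min \<delta> (b - a) / 2"
  have e: "0 < e" "e < \<delta>" "2 * e \<le> b - a"
    using \<delta>(1) \<open>a < b\<close> by (auto simp: e_def min_def)
  define x' where "x' = (if a \<le> r - e then r - e else r + e)"
  have "x' \<in> {a..b}" "x' \<noteq> r" "\<bar>x' - r\<bar> < \<delta>"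
    using e assms(3) \<open>x = r\<close> by (auto simp: x'_def)
  then show False
    using nonneg[of x'] \<delta>(2)[of x'] by force
qed

text \<open>
  The cofactor of \<open>x - r\<close> changes sign from nonpositive to nonnegative at \<open>r\<close>, so it vanishes
  there and supplies the second factor.
\<close>

lemma interior_root_square_dvd:
  fixes p :: "real poly"
  assumes "a < r" "r < b" and nonneg: "\<And>x. x \<in> {a..b} \<Longrightarrow> 0 \<le> poly p x" and "poly p r = 0"
  shows "[:- r, 1:]\<^sup>2 dvd p"
proof -
  obtain q where q: "p = [:- r, 1:] * q"
    using \<open>poly p r = 0\<close> by (auto simp: poly_eq_0_iff_dvd)
  have "0 \<le> poly q x" if "x \<in> {r..b}" "x \<noteq> r" for x
  proof -
    have "0 \<le> (x - r) * poly q x"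
      using nonneg[of x] that assms(1) by (simp add: q algebra_simps)
    then show ?thesis
      using that by (simp add: zero_le_mult_iff)
  qed
  from poly_nonneg_except_point[OF \<open>r < b\<close> this, of r] have "0 \<le> poly q r"
    using \<open>r < b\<close> by simp
  moreover have "0 \<le> poly (- q) x" if "x \<in> {a..r}" "x \<noteq> r" for x
  proof -
    have "0 \<le> (x - r) * poly q x"
      using nonneg[of x] that assms(2) by (simp add: q algebra_simps)
    then show ?thesis
      using that by (simp add: zero_le_mult_iff)
  qed
  from poly_nonneg_except_point[OF \<open>a < r\<close> this, of r] have "poly q r \<le> 0"
    using \<open>a < r\<close> by simp
  ultimately have "[:- r, 1:] dvd q"
    by (simp add: poly_eq_0_iff_dvd)
  then show ?thesis
    unfolding q power2_eq_square by (rule mult_dvd_mono[OF dvd_refl])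
qed

text \<open>
  The theorem of Markov and Lukacs, by induction on the degree bound. After subtraction of its
  minimum \<open>p r\<close>, which is a nonnegative constant and can be added back to a certificate, the
  polynomial has a root at the minimizer \<open>r\<close>. That root splits off \<open>x - a\<close>, \<open>b - x\<close> or, inside the
  interval, \<open>(x - r)\<^sup>2\<close>; the cofactor is again nonnegative and of smaller degree.
\<close>

theorem interval_cert_if_nonneg:
  assumes "a < b" and "degree p \<le> n" and "\<And>x. x \<in> {a..b} \<Longrightarrow> 0 \<le> poly p x"
  shows "interval_cert a b n p"
  using assms(2,3)
proof (induction n arbitrary: p rule: less_induct)
  case (less n)
  have "compact {a..b}" "{a..b} \<noteq> {}"
    using \<open>a < b\<close> by simp_all
  then obtain r where r: "r \<in> {a..b}" "\<And>x. x \<in> {a..b} \<Longrightarrow> poly p r \<le> poly p x"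
    using poly_attains_min by blast
  define g where "g = p - [:poly p r:]"
  have g: "poly g r = 0" "\<And>x. x \<in> {a..b} \<Longrightarrow> 0 \<le> poly g x" "degree g \<le> n"
    using r(2) less.prems(1) by (auto simp: g_def intro: degree_diff_le)
  have "interval_cert a b n g"
  proof (cases "g = 0")
    case True
    then show ?thesis
      by (simp add: interval_cert_0)
  next
    case False
    have r_cases: "r = a \<or> r = b \<or> (a < r \<and> r < b)"
      using r(1) by force
    then show ?thesis
    proof (elim disjE conjE)
      assume "r = a"
      then obtain q where q: "g = [:- a, 1:] * q"
        using g(1) by (auto simp: poly_eq_0_iff_dvd)
      then have "q \<noteq> 0" "degree g = Suc (degree q)"
        using False by (auto simp: degree_mult_eq simp del: mult_pCons_left)
      then obtain k where k: "n = Suc k" "degree q \<le> k"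
        using g(3) by (cases n) auto
      have "0 \<le> poly q x" if "x \<in> {a..b}" "x \<noteq> a" for x
      proof -
        have "0 \<le> (x - a) * poly q x"
          using g(2)[OF that(1)] by (simp add: q algebra_simps)
        then show ?thesis
          using that by (simp add: zero_le_mult_iff)
      qed
      then have "interval_cert a b k q"
        using poly_nonneg_except_point[OF \<open>a < b\<close>] k by (intro less.IH) blast+
      then show ?thesis
        unfolding q k by (rule interval_cert_mult_endpoint(1))
    next
      assume "r = b"
      then obtain q' where "g = [:- b, 1:] * q'"
        using g(1) by (auto simp: poly_eq_0_iff_dvd)
      then have "g = [:b, - 1:] * (- q')"
        by simp
      then obtain q where q: "g = [:b, - 1:] * q"
        by blast
      then have "q \<noteq> 0" "degree g = Suc (degree q)"
        using False by (auto simp: degree_mult_eq simp del: mult_pCons_left)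
      then obtain k where k: "n = Suc k" "degree q \<le> k"
        using g(3) by (cases n) auto
      have "0 \<le> poly q x" if "x \<in> {a..b}" "x \<noteq> b" for x
      proof -
        have "0 \<le> (b - x) * poly q x"
          using g(2)[OF that(1)] by (simp add: q algebra_simps)
        then show ?thesis
          using that by (simp add: zero_le_mult_iff)
      qed
      then have "interval_cert a b k q"
        using poly_nonneg_except_point[OF \<open>a < b\<close>] k by (intro less.IH) blast+
      then show ?thesis
        unfolding q k by (rule interval_cert_mult_endpoint(2))
    next
      assume "a < r" "r < b"
      then have "[:- r, 1:]\<^sup>2 dvd g"
        using g by (intro interior_root_square_dvd) auto
      then obtain q where q: "g = [:- r, 1:]\<^sup>2 * q"
        by blast
      then have "q \<noteq> 0" "degree g = Suc (Suc (degree q))"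
        using False by (auto simp: degree_mult_eq degree_power_eq simp del: mult_pCons_left)
      moreover from this obtain k where k: "n = Suc (Suc k)"
        using g(3) by (metis Suc_le_D Suc_le_mono)
      ultimately have "degree q \<le> k"
        using g(3) by simp
      have "0 \<le> poly q x" if "x \<in> {a..b}" "x \<noteq> r" for x
      proof -
        have "0 \<le> (x - r)\<^sup>2 * poly q x"
          using g(2)[OF that(1)] by (simp add: q)
        then show ?thesis
          using that by (simp add: zero_le_mult_iff)
      qed
      then have "interval_cert a b k q"
        using poly_nonneg_except_point[OF \<open>a < b\<close>] k \<open>degree q \<le> k\<close> by (intro less.IH) auto
      then show ?thesis
        unfolding q k by (rule interval_cert_mult_square)
    qed
  qed
  then have "interval_cert a b n (g + [:poly p r:])"
    using \<open>a < b\<close> less.prems(2)[OF r(1)] by (rule interval_cert_add_const)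
  then show ?case
    by (simp add: g_def)
qed

section \<open>Gram matrices\<close>

lemma quadratic_form_eq_sum:
  assumes "A \<in> carrier_mat n n" and "v \<in> carrier_vec n"
  shows "scalar_prod v (A *\<^sub>v v) = (\<Sum>i<n. \<Sum>j<n. v $ i * (A $$ (i, j) * v $ j))"
  using assms
  by (auto simp: scalar_prod_def sum_distrib_left lessThan_atLeast0 intro!: sum.cong)

lemma gram_poly_eq_sum:
  assumes "A \<in> carrier_mat n n"
  shows "gram_poly n A = (\<Sum>i<n. \<Sum>j<n. monom (A $$ (i, j)) (i + j))"
proof -
  have "gram_poly n A = (\<Sum>i<n. \<Sum>j<n. monom 1 i * ([:A $$ (i, j):] * monom 1 j))"
    unfolding gram_poly_def using assms
    by (subst quadratic_form_eq_sum[where n = n]) (auto simp: monomials_def intro!: sum.cong)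
  also have "\<dots> = (\<Sum>i<n. \<Sum>j<n. monom (A $$ (i, j)) (i + j))"
    by (intro sum.cong refl) (simp add: mult_monom smult_monom)
  finally show ?thesis .
qed

lemma poly_gram_poly_nonneg:
  assumes "A \<in> psd_mats n"
  shows "0 \<le> poly (gram_poly n A) x"
proof -
  have A: "A \<in> carrier_mat n n"
    using assms by (simp add: psd_mats_def)
  let ?v = "Matrix.vec n (\<lambda>i. x ^ i)"
  have "poly (gram_poly n A) x = scalar_prod ?v (A *\<^sub>v ?v)"
    by (subst quadratic_form_eq_sum[OF A])
      (auto simp: gram_poly_eq_sum[OF A] poly_sum poly_monom power_add intro!: sum.cong)
  then show ?thesis
    using assms by (simp add: psd_mats_def)
qed

lemma coeff_sum_below:
  assumes "degree q < n"
  shows "(\<Sum>i<n. monom (coeff q i) i) = q"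
  using poly_as_sum_of_monoms'[of q "n - 1"] assms
  by (cases n) (auto simp: lessThan_Suc_atMost)

lemma zero_psd: "0\<^sub>m n n \<in> psd_mats n"
  by (auto simp: psd_mats_def quadratic_form_eq_sum[where n = n])

lemma add_psd:
  assumes "A \<in> psd_mats n" "B \<in> psd_mats n"
  shows "A + B \<in> psd_mats n"
proof -
  have AB: "A \<in> carrier_mat n n" "B \<in> carrier_mat n n"
    using assms by (auto simp: psd_mats_def)
  have "0 \<le> scalar_prod v ((A + B) *\<^sub>v v)" if v: "v \<in> carrier_vec n" for v
    using assms v AB
    by (simp add: psd_mats_def add_mult_distrib_mat_vec[OF AB v] scalar_prod_add_distrib[of _ n])
  then show ?thesis
    using assms AB by (auto simp: psd_mats_def transpose_add[OF AB])
qed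

lemma gram_poly_add:
  assumes "A \<in> carrier_mat n n" "B \<in> carrier_mat n n"
  shows "gram_poly n (A + B) = gram_poly n A + gram_poly n B"
  using assms by (simp add: gram_poly_eq_sum add_monom[symmetric] sum.distrib)

text \<open>
  The Gram matrix is the rank-one matrix \<open>c c\<^sup>T\<close> of the coefficient vector \<open>c\<close> of \<open>q\<close>.
\<close>

lemma square_gram:
  assumes "degree q < n"
  shows "\<exists>X \<in> psd_mats n. gram_poly n X = q\<^sup>2"
proof
  let ?X = "Matrix.mat n n (\<lambda>(i, j). coeff q i * coeff q j)"
  have "scalar_prod v (?X *\<^sub>v v) = (\<Sum>i<n. v $ i * coeff q i)\<^sup>2" if "v \<in> carrier_vec n" for v
    by (subst quadratic_form_eq_sum[OF _ that])
      (auto simp: power2_eq_square sum_product algebra_simps intro!: sum.cong)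
  then show "?X \<in> psd_mats n"
    by (auto simp: psd_mats_def intro!: eq_matI)
  have "gram_poly n ?X = (\<Sum>i<n. monom (coeff q i) i)\<^sup>2"
    by (subst gram_poly_eq_sum[of _ n])
      (auto simp: power2_eq_square sum_product mult_monom intro!: sum.cong)
  then show "gram_poly n ?X = q\<^sup>2"
    by (simp add: coeff_sum_below[OF assms])
qed

lemma sos_gram:
  assumes "sos n p"
  shows "\<exists>X \<in> psd_mats n. gram_poly n X = p"
proof -
  have "\<exists>X \<in> psd_mats n. gram_poly n X = (\<Sum>q \<leftarrow> qs. q\<^sup>2)"
    if "\<forall>q \<in> set qs. degree q < n" for qs
    using that
  proof (induction qs)
    case Nil
    have "gram_poly n (0\<^sub>m n n) = 0"
      by (simp add: gram_poly_eq_sum)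
    then show ?case
      using zero_psd by auto
  next
    case (Cons q qs)
    then obtain X where X: "X \<in> psd_mats n" "gram_poly n X = (\<Sum>q \<leftarrow> qs. q\<^sup>2)"
      by auto
    obtain Y where Y: "Y \<in> psd_mats n" "gram_poly n Y = q\<^sup>2"
      using square_gram Cons.prems by (metis list.set_intros(1))
    have "gram_poly n (Y + X) = (\<Sum>q \<leftarrow> q # qs. q\<^sup>2)"
      using X Y by (subst gram_poly_add) (auto simp: psd_mats_def)
    then show ?case
      using add_psd[OF Y(1) X(1)] by blast
  qed
  then show ?thesis
    using assms unfolding sos_def by blast
qed

section \<open>Truncated moment functionals\<close>

lemma pairing_0 [simp]: "pairing 0 y = 0"
  by (simp add: pairing_def)

lemma pairing_add: "pairing (p + q) y = pairing p y + pairing q y"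
  by (simp add: pairing_def distrib_right sum.distrib)

lemma pairing_diff: "pairing (p - q) y = pairing p y - pairing q y"
  by (simp add: pairing_def left_diff_distrib sum_subtractf)

lemma pairing_smult: "pairing (Polynomial.smult c p) y = c * pairing p y"
  by (simp add: pairing_def sum_distrib_left mult.assoc)

lemma pairing_sum: "pairing (\<Sum>i\<in>A. p i) y = (\<Sum>i\<in>A. pairing (p i) y)"
  by (induction A rule: infinite_finite_induct) (simp_all add: pairing_add)

lemma pairing_sum_list: "pairing (\<Sum>q\<leftarrow>qs. p q) y = (\<Sum>q\<leftarrow>qs. pairing (p q) y)"
  by (induction qs) (simp_all add: pairing_add)

lemma pairing_monom: "k < dim_vec y \<Longrightarrow> pairing (monom c k) y = c * y $ k"
  by (simp add: pairing_def if_distrib[of "\<lambda>x. x * _"] cong: if_cong)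

lemma pairing_const: "0 < dim_vec y \<Longrightarrow> pairing [:c:] y = c * y $ 0"
  using pairing_monom[of 0 y c] by (simp add: monom_0)

text \<open>
  The localizing matrix of a weight \<open>g\<close>. Each linear matrix inequality of the moment relaxation
  says that one such matrix is positive semidefinite.
\<close>

definition localizing :: "real poly \<Rightarrow> nat \<Rightarrow> real vec \<Rightarrow> real mat" where
  "localizing g n y = Matrix.mat n n (\<lambda>(i, j). pairing (g * monom 1 (i + j)) y)"

lemma localizing_quadratic_form:
  assumes "v \<in> carrier_vec n"
  shows "scalar_prod v (localizing g n y *\<^sub>v v) = pairing (g * (\<Sum>i<n. monom (v $ i) i)\<^sup>2) y"
proof -
  have "(\<Sum>i<n. monom (v $ i) i)\<^sup>2
      = (\<Sum>i<n. \<Sum>j<n. Polynomial.smult (v $ i * v $ j) (monom 1 (i + j)))"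
    by (simp add: power2_eq_square sum_product mult_monom smult_monom)
  then have "pairing (g * (\<Sum>i<n. monom (v $ i) i)\<^sup>2) y
      = (\<Sum>i<n. \<Sum>j<n. v $ i * v $ j * pairing (g * monom 1 (i + j)) y)"
    by (simp add: sum_distrib_left pairing_sum pairing_smult)
  moreover have "localizing g n y \<in> carrier_mat n n"
    by (simp add: localizing_def)
  then have "scalar_prod v (localizing g n y *\<^sub>v v)
      = (\<Sum>i<n. \<Sum>j<n. v $ i * v $ j * pairing (g * monom 1 (i + j)) y)"
    using assms by (subst quadratic_form_eq_sum) (auto simp: localizing_def mult_ac intro!: sum.cong)
  ultimately show ?thesis
    by simp
qed

text \<open>
  A coefficient vector is a polynomial, so positive semidefiniteness is nonnegativity of the
  functional on weighted squares.
\<close>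

lemma localizing_psd_iff:
  "localizing g n y \<in> psd_mats n \<longleftrightarrow> (\<forall>q. degree q < n \<longrightarrow> 0 \<le> pairing (g * q\<^sup>2) y)"
proof (intro iffI allI impI)
  fix q :: "real poly" assume psd: "localizing g n y \<in> psd_mats n" and q: "degree q < n"
  let ?v = "Matrix.vec n (coeff q)"
  have v: "?v \<in> carrier_vec n"
    by simp
  have "0 \<le> scalar_prod ?v (localizing g n y *\<^sub>v ?v)"
    using psd v unfolding psd_mats_def by blast
  moreover have "(\<Sum>i<n. monom (?v $ i) i) = q"
    using coeff_sum_below[OF q] by simp
  ultimately show "0 \<le> pairing (g * q\<^sup>2) y"
    by (simp only: localizing_quadratic_form[OF v])
next
  assume *: "\<forall>q. degree q < n \<longrightarrow> 0 \<le> pairing (g * q\<^sup>2) y"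
  have "0 \<le> scalar_prod v (localizing g n y *\<^sub>v v)" if v: "v \<in> carrier_vec n" for v
  proof (cases "n = 0")
    case True
    then show ?thesis
      unfolding localizing_quadratic_form[OF v] by simp
  next
    case False
    have "degree (monom (v $ i) i) < n" if "i < n" for i
      using degree_monom_le[of "v $ i" i] that by linarith
    then have "degree (\<Sum>i<n. monom (v $ i) i) < n"
      using False by (intro degree_sum_less) auto
    then show ?thesis
      using * by (simp add: localizing_quadratic_form[OF v])
  qed
  moreover have "localizing g n y \<in> carrier_mat n n"
    by (simp add: localizing_def)
  moreover have "transpose_mat (localizing g n y) = localizing g n y"
    by (rule eq_matI) (simp_all add: localizing_def add.commute)
  ultimately show "localizing g n y \<in> psd_mats n"
    unfolding psd_mats_def by blast
qed

lemma hankel_eq_localizing: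
  assumes "2 * n \<le> dim_vec y + 1"
  shows "hankel 0 n y = localizing 1 n y"
  using assms by (intro eq_matI) (auto simp: hankel_def localizing_def pairing_monom)

lemma hankel_right_eq_localizing:
  assumes "2 * n \<le> dim_vec y"
  shows "c \<cdot>\<^sub>m hankel 0 n y - hankel 1 n y = localizing [:c, - 1:] n y"
proof -
  have "[:c, - 1:] * monom 1 k = Polynomial.smult c (monom 1 k) - monom 1 (Suc k)" for k
    by (simp add: monom_Suc)
  then show ?thesis
    using assms
    by (intro eq_matI)
      (auto simp: hankel_def localizing_def pairing_diff pairing_smult pairing_monom
        simp del: mult_pCons_left)
qed

lemma hankel_left_eq_localizing:
  assumes "2 * n \<le> dim_vec y"
  shows "hankel 1 n y - c \<cdot>\<^sub>m hankel 0 n y = localizing [:- c, 1:] n y"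
proof -
  have "[:- c, 1:] * monom 1 k = monom 1 (Suc k) - Polynomial.smult c (monom 1 k)" for k
    by (simp add: monom_Suc)
  then show ?thesis
    using assms
    by (intro eq_matI)
      (auto simp: hankel_def localizing_def pairing_diff pairing_smult pairing_monom
        simp del: mult_pCons_left)
qed

lemma hankel_product_eq_localizing:
  assumes "2 * n + 1 \<le> dim_vec y"
  shows "(a + b) \<cdot>\<^sub>m hankel 1 n y - ((a * b) \<cdot>\<^sub>m hankel 0 n y + hankel 2 n y)
    = localizing ([:- a, 1:] * [:b, - 1:]) n y"
proof -
  have "[:- a, 1:] * [:b, - 1:] * monom 1 k = Polynomial.smult (a + b) (monom 1 (Suc k))
      - (Polynomial.smult (a * b) (monom 1 k) + monom 1 (Suc (Suc k)))" for k
    by (simp add: monom_Suc algebra_simps smult_add_left)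
  then show ?thesis
    using assms
    by (intro eq_matI)
      (auto simp: hankel_def localizing_def pairing_diff pairing_add pairing_smult pairing_monom
        simp del: mult_pCons_left mult_pCons_right)
qed

text \<open>
  The constraints that the moment relaxation puts on a single block \<open>y\<^sup>(\<^sup>l\<^sup>)\<close>.
\<close>

definition interval_moments :: "real \<Rightarrow> real \<Rightarrow> nat \<Rightarrow> real vec \<Rightarrow> bool" where
  "interval_moments a b d y \<longleftrightarrow> y \<in> carrier_vec (d + 1) \<and>
     (if odd d
      then localizing [:b, - 1:] (d div 2 + 1) y \<in> psd_mats (d div 2 + 1) \<and>
           localizing [:- a, 1:] (d div 2 + 1) y \<in> psd_mats (d div 2 + 1)
      else localizing 1 (d div 2 + 1) y \<in> psd_mats (d div 2 + 1) \<and>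
           localizing ([:- a, 1:] * [:b, - 1:]) (d div 2) y \<in> psd_mats (d div 2))"

lemma interval_moments_odd_iff:
  assumes "odd d"
  shows "interval_moments a b d y \<longleftrightarrow> y \<in> carrier_vec (2 * (d div 2) + 2) \<and>
    loewner_ge (d div 2 + 1) (b \<cdot>\<^sub>m hankel 0 (d div 2 + 1) y) (hankel 1 (d div 2 + 1) y) \<and>
    loewner_ge (d div 2 + 1) (hankel 1 (d div 2 + 1) y) (a \<cdot>\<^sub>m hankel 0 (d div 2 + 1) y)"
proof -
  have d: "2 * (d div 2) + 2 = d + 1"
    using assms by presburger
  show ?thesis
  proof (cases "y \<in> carrier_vec (d + 1)")
    case True
    then have dims: "2 * (d div 2 + 1) \<le> dim_vec y"
      using d by simp
    show ?thesis
      using True assms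
      unfolding interval_moments_def loewner_ge_def d
        hankel_right_eq_localizing[OF dims] hankel_left_eq_localizing[OF dims]
      by (simp only: not_False_eq_True if_True)
  next
    case False
    then show ?thesis
      unfolding interval_moments_def d by blast
  qed
qed

lemma interval_moments_even_iff:
  assumes "even d"
  shows "interval_moments a b d y \<longleftrightarrow> y \<in> carrier_vec (2 * (d div 2) + 1) \<and>
    hankel 0 (d div 2 + 1) y \<in> psd_mats (d div 2 + 1) \<and>
    loewner_ge (d div 2) ((a + b) \<cdot>\<^sub>m hankel 1 (d div 2) y)
      ((a * b) \<cdot>\<^sub>m hankel 0 (d div 2) y + hankel 2 (d div 2) y)"
proof -
  have d: "2 * (d div 2) + 1 = d + 1"
    using assms by presburger
  show ?thesis
  proof (cases "y \<in> carrier_vec (d + 1)")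
    case True
    then have dims: "2 * (d div 2 + 1) \<le> dim_vec y + 1" "2 * (d div 2) + 1 \<le> dim_vec y"
      using d by simp_all
    show ?thesis
      using True assms
      unfolding interval_moments_def loewner_ge_def d
        hankel_eq_localizing[OF dims(1)] hankel_product_eq_localizing[OF dims(2)]
      by (simp only: not_True_eq_False if_False)
  next
    case False
    then show ?thesis
      unfolding interval_moments_def d by blast
  qed
qed

lemma mom_feasible_iff:
  "mom_feasible m a b d y \<longleftrightarrow>
     (\<forall>l \<in> {1..m}. interval_moments (a l) (b l) d (y l)) \<and> (\<Sum>l = 1..m. y l $ 0) = 1"
proof (cases "odd d")
  case True
  show ?thesis
    unfolding mom_feasible_def mom_feasible_odd_def interval_moments_odd_iff[OF True]
    using True by (simp only: not_False_eq_True if_True) blast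
next
  case False
  then have "even d"
    by blast
  show ?thesis
    unfolding mom_feasible_def mom_feasible_even_def interval_moments_even_iff[OF \<open>even d\<close>]
    using False by (simp only: not_True_eq_False if_False) blast
qed

lemma localizing_pairing_nonneg:
  assumes "localizing g n y \<in> psd_mats n" and "sos n s"
  shows "0 \<le> pairing (g * s) y"
proof -
  obtain qs where qs: "\<forall>q \<in> set qs. degree q < n" "s = (\<Sum>q \<leftarrow> qs. q\<^sup>2)"
    using assms(2) unfolding sos_def by blast
  have "pairing (g * s) y = (\<Sum>q \<leftarrow> qs. pairing (g * q\<^sup>2) y)"
    by (simp add: qs(2) sum_list_const_mult[symmetric] pairing_sum_list)
  also have "0 \<le> \<dots>"
    using assms(1) qs(1) unfolding localizing_psd_iff by (intro sum_list_nonneg) auto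
  finally show ?thesis .
qed

lemma interval_cert_cases:
  assumes "interval_cert a b d p"
  obtains (odd) s t where "odd d" "sos (d div 2 + 1) s" "sos (d div 2 + 1) t"
      "p = [:- a, 1:] * s + [:b, - 1:] * t"
  | (even) s t where "even d" "sos (d div 2 + 1) s" "sos (d div 2) t"
      "p = s + [:- a, 1:] * [:b, - 1:] * t"
proof (cases "odd d")
  case True
  then show ?thesis
    using assms odd unfolding interval_cert_def
    by (simp only: not_False_eq_True if_True) blast
next
  case False
  then show ?thesis
    using assms even unfolding interval_cert_def by (simp only: if_False) blast
qed

lemma interval_moments_pairing_nonneg:
  assumes "interval_moments a b d y" and "interval_cert a b d p"
  shows "0 \<le> pairing p y"
  using assms(2)
proof (cases rule: interval_cert_cases)
  case (odd s t)
  then have "0 \<le> pairing ([:- a, 1:] * s) y" "0 \<le> pairing ([:b, - 1:] * t) y"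
    using assms(1) unfolding interval_moments_def
    by (metis localizing_pairing_nonneg)+
  then show ?thesis
    unfolding odd(4) pairing_add by (rule add_nonneg_nonneg)
next
  case (even s t)
  then have "0 \<le> pairing (1 * s) y" "0 \<le> pairing ([:- a, 1:] * [:b, - 1:] * t) y"
    using assms(1) unfolding interval_moments_def
    by (metis localizing_pairing_nonneg)+
  then show ?thesis
    unfolding even(4) pairing_add mult_1 by (rule add_nonneg_nonneg)
qed

lemma pairing_point_moments:
  assumes "degree p < n"
  shows "pairing p (Matrix.vec n (\<lambda>i. x ^ i)) = poly p x"
proof -
  have "poly p x = poly (\<Sum>i<n. monom (coeff p i) i) x"
    using coeff_sum_below[OF assms] by simp
  also have "\<dots> = pairing p (Matrix.vec n (\<lambda>i. x ^ i))"
    by (simp add: pairing_def poly_sum poly_monom)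
  finally show ?thesis ..
qed

lemma localizing_point_psd:
  assumes "0 \<le> poly g x" and "degree g + 2 * n \<le> d + 2"
  shows "localizing g n (Matrix.vec (d + 1) (\<lambda>i. x ^ i)) \<in> psd_mats n"
  unfolding localizing_psd_iff
proof (intro allI impI)
  fix q :: "real poly" assume "degree q < n"
  moreover have "degree (g * q\<^sup>2) \<le> degree g + 2 * degree q"
    using degree_mult_le[of g "q\<^sup>2"] degree_power_le[of q 2] by linarith
  ultimately have "degree (g * q\<^sup>2) < d + 1"
    using assms(2) by linarith
  then show "0 \<le> pairing (g * q\<^sup>2) (Matrix.vec (d + 1) (\<lambda>i. x ^ i))"
    using assms(1) by (simp add: pairing_point_moments)
qed

text \<open>
  Feasibility of a point evaluation: it maps a weighted square \<open>g q\<^sup>2\<close> to \<open>g(x) q(x)\<^sup>2\<close>. The degree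
  of \<open>g q\<^sup>2\<close> never exceeds \<open>d\<close>, so truncation of the moment vector loses nothing.
\<close>

lemma interval_moments_point:
  assumes "x \<in> {a..b}"
  shows "interval_moments a b d (Matrix.vec (d + 1) (\<lambda>i. x ^ i))"
proof (cases "odd d")
  case True
  then have d: "1 + 2 * (d div 2 + 1) \<le> d + 2"
    by presburger
  have "localizing [:b, - 1:] (d div 2 + 1) (Matrix.vec (d + 1) (\<lambda>i. x ^ i)) \<in> psd_mats (d div 2 + 1)"
    using assms d by (intro localizing_point_psd) simp_all
  moreover have "localizing [:- a, 1:] (d div 2 + 1) (Matrix.vec (d + 1) (\<lambda>i. x ^ i))
      \<in> psd_mats (d div 2 + 1)"
    using assms d by (intro localizing_point_psd) simp_all
  ultimately show ?thesis
    using True unfolding interval_moments_def by simp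
next
  case False
  have "localizing 1 (d div 2 + 1) (Matrix.vec (d + 1) (\<lambda>i. x ^ i)) \<in> psd_mats (d div 2 + 1)"
    by (rule localizing_point_psd) simp_all
  moreover have "localizing ([:- a, 1:] * [:b, - 1:]) (d div 2) (Matrix.vec (d + 1) (\<lambda>i. x ^ i))
      \<in> psd_mats (d div 2)"
  proof (rule localizing_point_psd)
    show "0 \<le> poly ([:- a, 1:] * [:b, - 1:]) x"
      using assms unfolding poly_mult by simp
    have "degree ([:- a, 1:] * [:b, - 1:]) \<le> 2"
      using degree_mult_le[of "[:- a, 1:]" "[:b, - 1:]"] by simp
    then show "degree ([:- a, 1:] * [:b, - 1:]) + 2 * (d div 2) \<le> d + 2"
      by presburger
  qed
  ultimately show ?thesis
    using False unfolding interval_moments_def by (simp del: mult_pCons_left mult_pCons_right)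
qed

lemma interval_moments_zero: "interval_moments a b d (0\<^sub>v (d + 1))"
proof -
  have "pairing p (0\<^sub>v n) = 0" for p n
    by (simp add: pairing_def)
  then show ?thesis
    by (simp add: interval_moments_def localizing_psd_iff del: mult_pCons_left mult_pCons_right)
qed

section \<open>The sum-of-squares relaxation\<close>

lemma sos_feasible_lower_bound:
  assumes "sos_feasible f m a b d \<gamma> X Y" and "l \<in> {1..m}" and "x \<in> {a l..b l}"
  shows "\<gamma> \<le> poly f x"
proof -
  have "0 \<le> poly (f - [:\<gamma>:]) x"
  proof (cases "odd d")
    case True
    then have XY: "X l \<in> psd_mats (d div 2 + 1)" "Y l \<in> psd_mats (d div 2 + 1)"
        "f - [:\<gamma>:] = [:- a l, 1:] * gram_poly (d div 2 + 1) (X l)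
           + [:b l, - 1:] * gram_poly (d div 2 + 1) (Y l)"
      using assms(1,2) unfolding sos_feasible_def sos_feasible_odd_def
      by (simp_all only: not_False_eq_True if_True)
    then show ?thesis
      unfolding XY(3) poly_add poly_mult
      using assms(3) poly_gram_poly_nonneg[OF XY(1)] poly_gram_poly_nonneg[OF XY(2)] by simp
  next
    case False
    then have XY: "X l \<in> psd_mats (d div 2 + 1)" "Y l \<in> psd_mats (d div 2)"
        "f - [:\<gamma>:] = gram_poly (d div 2 + 1) (X l)
           + [:- a l, 1:] * [:b l, - 1:] * gram_poly (d div 2) (Y l)"
      using assms(1,2) unfolding sos_feasible_def sos_feasible_even_def
      by (simp_all only: if_False)
    then show ?thesis
      unfolding XY(3) poly_add poly_mult
      using assms(3) poly_gram_poly_nonneg[OF XY(1)] poly_gram_poly_nonneg[OF XY(2)] by simp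
  qed
  then show ?thesis
    by simp
qed

lemma sos_feasible_if_certs:
  assumes certs: "\<And>l. l \<in> {1..m} \<Longrightarrow> interval_cert (a l) (b l) d (f - [:\<gamma>:])"
  shows "\<exists>X Y. sos_feasible f m a b d \<gamma> X Y"
proof (cases "odd d")
  case True
  have "\<exists>X Y. X \<in> psd_mats (d div 2 + 1) \<and> Y \<in> psd_mats (d div 2 + 1) \<and>
      f - [:\<gamma>:] = [:- a l, 1:] * gram_poly (d div 2 + 1) X
        + [:b l, - 1:] * gram_poly (d div 2 + 1) Y" if "l \<in> {1..m}" for l
    using certs[OF that]
  proof (cases rule: interval_cert_cases)
    case (odd s t)
    then show ?thesis
      using sos_gram by blast
  qed (use True in blast)
  then obtain X Y where "\<forall>l \<in> {1..m}. X l \<in> psd_mats (d div 2 + 1) \<and> Y l \<in> psd_mats (d div 2 + 1) \<and>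
      f - [:\<gamma>:] = [:- a l, 1:] * gram_poly (d div 2 + 1) (X l)
        + [:b l, - 1:] * gram_poly (d div 2 + 1) (Y l)"
    by metis
  then show ?thesis
    using True unfolding sos_feasible_def sos_feasible_odd_def
    by (simp only: not_False_eq_True if_True) blast
next
  case False
  have "\<exists>X Y. X \<in> psd_mats (d div 2 + 1) \<and> Y \<in> psd_mats (d div 2) \<and>
      f - [:\<gamma>:] = gram_poly (d div 2 + 1) X
        + [:- a l, 1:] * [:b l, - 1:] * gram_poly (d div 2) Y" if "l \<in> {1..m}" for l
    using certs[OF that]
  proof (cases rule: interval_cert_cases)
    case (even s t)
    then show ?thesis
      using sos_gram by blast
  qed (use False in blast)
  then obtain X Y where "\<forall>l \<in> {1..m}. X l \<in> psd_mats (d div 2 + 1) \<and> Y l \<in> psd_mats (d div 2) \<and>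
      f - [:\<gamma>:] = gram_poly (d div 2 + 1) (X l)
        + [:- a l, 1:] * [:b l, - 1:] * gram_poly (d div 2) (Y l)"
    by metis
  then show ?thesis
    using False unfolding sos_feasible_def sos_feasible_even_def
    by (simp only: if_False) blast
qed

section \<open>Functionals that annihilate a nonnegative polynomial\<close>

text \<open>
  Where \<open>g + e\<close> is not positive, \<open>p\<close> is positive and hence, by compactness, bounded away from \<open>0\<close>.
  So \<open>g + e + C p\<close> is nonnegative on \<open>K\<close> for large \<open>C\<close>. The functional does not see \<open>C p\<close>,
  whence its value at \<open>g\<close> is at least \<open>- e\<close> times its value at \<open>1\<close>; let \<open>e\<close> tend to \<open>0\<close>.
\<close>

lemma pairing_nonneg_if_nonneg_on_zeros:
  fixes p g :: "real poly"
  assumes "compact K"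
    and pos: "\<And>h. degree h \<le> d \<Longrightarrow> (\<And>x. x \<in> K \<Longrightarrow> 0 \<le> poly h x) \<Longrightarrow> 0 \<le> pairing h z"
    and p: "degree p \<le> d" "\<And>x. x \<in> K \<Longrightarrow> 0 \<le> poly p x" "pairing p z = 0"
    and g: "degree g \<le> d" "\<And>x. x \<in> K \<Longrightarrow> poly p x = 0 \<Longrightarrow> 0 \<le> poly g x"
  shows "0 \<le> pairing g z"
proof -
  have approx: "0 \<le> pairing g z + e * pairing 1 z" if "0 < e" for e
  proof -
    define W where "W = K \<inter> {x. poly g x + e \<le> 0}"
    have "compact W"
      unfolding W_def by (intro compact_Int_closed closed_Collect_le assms continuous_intros)
    have "\<exists>C. \<forall>x \<in> K. 0 \<le> poly g x + e + C * poly p x"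
    proof (cases "W = {}")
      case True
      then have "\<forall>x \<in> K. 0 \<le> poly g x + e + 0 * poly p x"
        by (force simp: W_def)
      then show ?thesis
        by blast
    next
      case False
      obtain w where w: "w \<in> W" "\<And>x. x \<in> W \<Longrightarrow> poly p w \<le> poly p x"
        using poly_attains_min[OF \<open>compact W\<close> False, of p] by blast
      obtain v where v: "v \<in> W" "\<And>x. x \<in> W \<Longrightarrow> poly g v \<le> poly g x"
        using poly_attains_min[OF \<open>compact W\<close> False, of g] by blast
      have "poly p w \<noteq> 0" "0 \<le> poly p w"
        using w(1) g(2)[of w] p(2)[of w] that by (auto simp: W_def)
      then have pw: "0 < poly p w"
        by simp
      have gv: "poly g v < 0"
        using v(1) that by (simp add: W_def)
      \<comment> \<open>The least value of \<open>C p\<close> on \<open>W\<close> then compensates the least value of \<open>g\<close>.\<close>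
      define C where "C = - poly g v / poly p w"
      have C: "0 \<le> C" "C * poly p w = - poly g v"
        using pw gv by (simp_all add: C_def divide_le_0_iff)
      have "0 \<le> poly g x + e + C * poly p x" if "x \<in> K" for x
      proof (cases "x \<in> W")
        case True
        then have "C * poly p w \<le> C * poly p x"
          using w(2) C(1) by (intro mult_left_mono)
        then show ?thesis
          using v(2)[OF True] C(2) \<open>0 < e\<close> by linarith
      next
        case False
        then have "0 < poly g x + e"
          using that by (auto simp: W_def)
        then show ?thesis
          using C(1) p(2)[OF that] by simp
      qed
      then show ?thesis
        by blast
    qed
    then obtain C where C: "\<forall>x \<in> K. 0 \<le> poly g x + e + C * poly p x"
      by blast
    have "0 \<le> pairing (g + Polynomial.smult e 1 + Polynomial.smult C p) z"
      using C g(1) p(1) by (intro pos degree_add_le) (auto intro: order_trans[OF degree_smult_le])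
    then show ?thesis
      unfolding pairing_add pairing_smult using p(3) by simp
  qed
  have one: "0 \<le> pairing 1 z"
    by (rule pos) simp_all
  show ?thesis
  proof (rule ccontr)
    assume neg: "\<not> 0 \<le> pairing g z"
    \<comment> \<open>With this \<open>e\<close> the bound collapses to a positive multiple of \<open>pairing g z\<close>.\<close>
    let ?e = "- pairing g z / (pairing 1 z + 1)"
    have "0 < ?e"
      using neg one by (simp add: divide_simps)
    moreover have "pairing g z + ?e * pairing 1 z = pairing g z / (pairing 1 z + 1)"
      using one by (simp add: field_simps)
    ultimately have "0 \<le> pairing g z / (pairing 1 z + 1)"
      using approx by metis
    then show False
      using neg one by (simp add: zero_le_divide_iff)
  qed
qed

definition lagrange_basis :: "real set \<Rightarrow> real \<Rightarrow> real poly" where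
  "lagrange_basis T t = (\<Prod>s \<in> T - {t}. Polynomial.smult (1 / (t - s)) [:- s, 1:])"

lemma poly_lagrange_basis:
  assumes "finite T" and "x \<in> T"
  shows "poly (lagrange_basis T t) x = (if x = t then 1 else 0)"
proof (cases "x = t")
  case True
  have "poly (lagrange_basis T t) t = (\<Prod>s \<in> T - {t}. 1)"
    unfolding lagrange_basis_def poly_prod
    by (intro prod.cong) (auto simp: diff_divide_distrib[symmetric])
  then show ?thesis
    using True by simp
next
  case False
  then show ?thesis
    using assms unfolding lagrange_basis_def poly_prod by (auto intro!: prod_zero bexI[of _ x])
qed

lemma degree_lagrange_basis:
  assumes "finite T"
  shows "degree (lagrange_basis T t) \<le> card T"
proof -
  have "degree (lagrange_basis T t) \<le> (\<Sum>s \<in> T - {t}. 1)"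
    unfolding lagrange_basis_def using assms
    by (intro order_trans[OF degree_prod_sum_le] sum_mono) (auto simp: degree_smult_le)
  also have "\<dots> \<le> card T"
    using card_mono[OF assms, of "T - {t}"] by simp
  finally show ?thesis .
qed

text \<open>
  A polynomial that vanishes on the zeros of \<open>p\<close> in \<open>K\<close> is annihilated, because both it and its
  negative are nonnegative there. So the functional depends only on the values at these zeros, and
  the Lagrange basis polynomials, which are nonnegative at all of them, give its weights. There are
  at most \<open>d\<close> zeros, so interpolation stays within the degrees on which the functional is
  controlled.
\<close>

lemma pairing_eq_sum_over_zeros:
  fixes p :: "real poly" and z :: "real vec" and K :: "real set"
  defines "Z \<equiv> {x \<in> K. poly p x = 0}"
  assumes "compact K"
    and pos: "\<And>h. degree h \<le> d \<Longrightarrow> (\<And>x. x \<in> K \<Longrightarrow> 0 \<le> poly h x) \<Longrightarrow> 0 \<le> pairing h z"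
    and p: "degree p \<le> d" "\<And>x. x \<in> K \<Longrightarrow> 0 \<le> poly p x" "pairing p z = 0" "p \<noteq> 0"
  shows "\<exists>c. (\<forall>t \<in> Z. 0 \<le> c t) \<and>
    (\<forall>g. degree g \<le> d \<longrightarrow> pairing g z = (\<Sum>t \<in> Z. c t * poly g t))"
proof (intro exI[of _ "\<lambda>t. pairing (lagrange_basis Z t) z"] conjI ballI allI impI)
  have fin: "finite Z"
    unfolding Z_def using poly_roots_finite[OF p(4)] by simp
  have "card Z \<le> degree p"
    unfolding Z_def
    by (rule order_trans[OF card_mono card_poly_roots_bound])
      (use p(4) poly_roots_finite[OF p(4)] in auto)
  then have deg: "degree (lagrange_basis Z t) \<le> d" for t
    using degree_lagrange_basis[OF fin, of t] p(1) by linarith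
  have nonneg: "0 \<le> pairing g z" if "degree g \<le> d" "\<And>x. x \<in> Z \<Longrightarrow> 0 \<le> poly g x" for g
    using that
    by (intro pairing_nonneg_if_nonneg_on_zeros[OF \<open>compact K\<close> pos p(1-3)]) (auto simp: Z_def)
  show "0 \<le> pairing (lagrange_basis Z t) z" if "t \<in> Z" for t
    using deg fin by (intro nonneg) (simp_all add: poly_lagrange_basis)
  fix g :: "real poly" assume g: "degree g \<le> d"
  define h where "h = (\<Sum>t \<in> Z. Polynomial.smult (poly g t) (lagrange_basis Z t))"
  have "degree h \<le> d"
    unfolding h_def using fin deg by (intro degree_sum_le) (auto intro: order_trans[OF degree_smult_le])
  moreover have "poly h x = poly g x" if "x \<in> Z" for x
  proof -
    have "poly h x = (\<Sum>t \<in> Z. if x = t then poly g t else 0)"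
      unfolding h_def poly_sum
      by (intro sum.cong) (simp_all add: poly_lagrange_basis[OF fin that])
    then show ?thesis
      using fin that by simp
  qed
  ultimately have "0 \<le> pairing (g - h) z" "0 \<le> pairing (h - g) z"
    using g by (auto intro!: nonneg degree_diff_le)
  then have "pairing g z = pairing h z"
    by (simp add: pairing_diff)
  also have "\<dots> = (\<Sum>t \<in> Z. pairing (lagrange_basis Z t) z * poly g t)"
    by (simp add: h_def pairing_sum pairing_smult mult.commute)
  finally show "pairing g z = (\<Sum>t \<in> Z. pairing (lagrange_basis Z t) z * poly g t)" .
qed

section \<open>Representing measures\<close>

lemma atomic_representing_measure:
  assumes "finite T" and c: "\<And>t. t \<in> T \<Longrightarrow> 0 \<le> c t"
    and z: "\<And>i. i < dim_vec z \<Longrightarrow> z $ i = (\<Sum>t \<in> T. c t * t ^ i)"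
  shows "\<exists>\<mu>. representing_measure \<mu> z \<and> measure_support \<mu> \<subseteq> T"
proof -
  define M where "M = point_measure T (\<lambda>t. ennreal (c t))"
  define \<mu> where "\<mu> = distr M borel (\<lambda>x. x)"
  have meas: "(\<lambda>x. x) \<in> measurable M borel"
    by (simp add: M_def)
  have "has_bochner_integral \<mu> (\<lambda>x. x ^ i) (z $ i)" if "i < dim_vec z" for i
  proof -
    have "integrable M (\<lambda>x. x ^ i)"
      unfolding M_def using assms(1) by (intro integrable_point_measure_finite)
    then have "integrable \<mu> (\<lambda>x. x ^ i)"
      unfolding \<mu>_def by (subst integrable_distr_eq[OF meas]) simp_all
    moreover have "integral\<^sup>L \<mu> (\<lambda>x. x ^ i) = integral\<^sup>L M (\<lambda>x. x ^ i)"
      unfolding \<mu>_def by (rule integral_distr[OF meas]) simp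
    moreover have "integral\<^sup>L M (\<lambda>x. x ^ i) = z $ i"
      unfolding M_def using assms(1) c
      by (subst lebesgue_integral_point_measure_finite) (simp_all add: z[OF that])
    ultimately show ?thesis
      by (simp add: has_bochner_integral_iff)
  qed
  then have "representing_measure \<mu> z"
    by (simp add: representing_measure_def \<mu>_def)
  moreover have "measure_support \<mu> \<subseteq> T"
  proof (rule measure_support_least)
    show "closed T"
      using assms(1) by (rule finite_imp_closed)
    then have "- T \<in> sets borel"
      by simp
    then have "emeasure \<mu> (- T) = emeasure M ((\<lambda>x. x) -` (- T) \<inter> space M)"
      unfolding \<mu>_def by (rule emeasure_distr[OF meas])
    also have "(\<lambda>x. x) -` (- T) \<inter> space M = {}"
      by (auto simp: M_def space_point_measure)
    finally show "emeasure \<mu> (- T) = 0"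
      by simp
  qed
  ultimately show ?thesis
    by blast
qed

lemma representing_measure_integral:
  assumes "representing_measure \<mu> z" and "degree p < dim_vec z"
  shows "has_bochner_integral \<mu> (poly p) (pairing p z)"
proof -
  have "has_bochner_integral \<mu> (\<lambda>x. \<Sum>i<dim_vec z. coeff p i * x ^ i) (pairing p z)"
    unfolding pairing_def using assms(1)
    by (intro has_bochner_integral_sum has_bochner_integral_mult_right)
      (auto simp: representing_measure_def)
  moreover have "poly p = (\<lambda>x. \<Sum>i<dim_vec z. coeff p i * x ^ i)"
  proof
    show "poly p x = (\<Sum>i<dim_vec z. coeff p i * x ^ i)" for x
      using arg_cong[OF coeff_sum_below[OF assms(2)], of "\<lambda>q. poly q x"]
      by (simp add: poly_sum poly_monom)
  qed
  ultimately show ?thesis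
    by simp
qed

text \<open>
  A nonnegative function with integral \<open>0\<close> vanishes almost everywhere, and the zeros form a closed
  set, which therefore contains the support.
\<close>

lemma measure_support_subset_zeros:
  assumes \<mu>: "representing_measure \<mu> z" "measure_support \<mu> \<subseteq> K" and "closed K"
    and p: "degree p < dim_vec z" "\<And>x. x \<in> K \<Longrightarrow> 0 \<le> poly p x" "pairing p z = 0"
  shows "measure_support \<mu> \<subseteq> {x \<in> K. poly p x = 0}"
proof (rule measure_support_least)
  have sets: "sets \<mu> = sets borel"
    using \<mu>(1) by (simp add: representing_measure_def)
  then have space: "space \<mu> = UNIV"
    by (metis sets_eq_imp_space_eq space_borel)
  have K: "AE x in \<mu>. x \<in> K"
  proof (rule AE_I)
    show "{x \<in> space \<mu>. x \<notin> K} \<subseteq> - measure_support \<mu>"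
      using \<mu>(2) by blast
    show "emeasure \<mu> (- measure_support \<mu>) = 0"
      by (rule emeasure_measure_support[OF sets])
    show "- measure_support \<mu> \<in> sets \<mu>"
      using closed_measure_support[of \<mu>] unfolding sets by simp
  qed
  have "has_bochner_integral \<mu> (poly p) 0"
    using representing_measure_integral[OF \<mu>(1) p(1)] p(3) by simp
  then have "integrable \<mu> (poly p)" "integral\<^sup>L \<mu> (poly p) = 0"
    by (simp_all add: has_bochner_integral_iff)
  moreover have "AE x in \<mu>. 0 \<le> poly p x"
    using K by eventually_elim (rule p(2))
  ultimately have "AE x in \<mu>. poly p x = 0"
    using integral_nonneg_eq_0_iff_AE by blast
  with K have "AE x in \<mu>. x \<in> {x \<in> K. poly p x = 0}"
    by eventually_elim simp
  moreover show closed: "closed {x \<in> K. poly p x = 0}"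
  proof -
    have "{x \<in> K. poly p x = 0} = K \<inter> {x. poly p x = 0}"
      by blast
    then show ?thesis
      using \<open>closed K\<close> by (auto intro!: closed_Int closed_Collect_eq continuous_intros)
  qed
  moreover have "- {x \<in> K. poly p x = 0} \<in> sets \<mu>"
    using closed unfolding sets by simp
  ultimately show "emeasure \<mu> (- {x \<in> K. poly p x = 0}) = 0"
    by (subst (asm) AE_iff_measurable) (auto simp: space)
qed

section \<open>Counting zeros\<close>

lemma mem_intervals_unionI: "l \<in> {1..m} \<Longrightarrow> x \<in> {a l..b l} \<Longrightarrow> x \<in> intervals_union m a b"
  unfolding intervals_union_def by blast

text \<open>
  A zero is an endpoint of some interval or lies in the interior of one. The interior ones are
  roots of multiplicity at least two, so there are at most half as many as the degree.
\<close>

lemma card_zeros_of_nonneg: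
  fixes p :: "real poly"
  assumes "p \<noteq> 0" and nonneg: "\<And>x. x \<in> intervals_union m a b \<Longrightarrow> 0 \<le> poly p x"
  shows "card {x \<in> intervals_union m a b. poly p x = 0} \<le> 2 * m + degree p div 2"
proof -
  define I where "I = {x. poly p x = 0 \<and> (\<exists>l \<in> {1..m}. a l < x \<and> x < b l)}"
  have roots: "finite {x. poly p x = 0}"
    using \<open>p \<noteq> 0\<close> by (rule poly_roots_finite)
  then have fin: "finite I"
    by (rule rev_finite_subset) (auto simp: I_def)
  have "2 \<le> order x p" if "x \<in> I" for x
  proof -
    obtain l where l: "l \<in> {1..m}" "a l < x" "x < b l" "poly p x = 0"
      using \<open>x \<in> I\<close> by (auto simp: I_def)
    have "0 \<le> poly p x'" if "x' \<in> {a l..b l}" for x'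
      using l(1) that by (intro nonneg mem_intervals_unionI)
    with l(2-4) have "[:- x, 1:]\<^sup>2 dvd p"
      by (intro interior_root_square_dvd)
    then show ?thesis
      using \<open>p \<noteq> 0\<close> by (simp add: order_divides)
  qed
  then have "(\<Sum>x \<in> I. 2) \<le> (\<Sum>x \<in> I. order x p)"
    by (rule sum_mono)
  also have "\<dots> \<le> (\<Sum>x \<in> {x. poly p x = 0}. order x p)"
    using roots by (intro sum_mono2) (auto simp: I_def)
  also have "\<dots> = size (proots p)"
    using \<open>p \<noteq> 0\<close> by (simp add: size_multiset_overloaded_eq)
  also have "\<dots> \<le> degree p"
    by (rule size_proots_le)
  finally have "card I \<le> degree p div 2"
    by simp
  have "{x \<in> intervals_union m a b. poly p x = 0} \<subseteq> (a ` {1..m} \<union> b ` {1..m}) \<union> I"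
    by (force simp: intervals_union_def I_def)
  then have "card {x \<in> intervals_union m a b. poly p x = 0} \<le> card ((a ` {1..m} \<union> b ` {1..m}) \<union> I)"
    using fin by (intro card_mono) auto
  also have "\<dots> \<le> card (a ` {1..m}) + card (b ` {1..m}) + card I"
    using card_Un_le[of "a ` {1..m}" "b ` {1..m}"] card_Un_le[of "a ` {1..m} \<union> b ` {1..m}" I]
    by linarith
  also have "\<dots> \<le> m + m + degree p div 2"
    using card_image_le[of "{1..m}" a] card_image_le[of "{1..m}" b] \<open>card I \<le> degree p div 2\<close>
    by simp
  finally show ?thesis
    by simp
qed

lemma ceiling_half_pred: "\<lceil>(real d - 1) / 2\<rceil> = int (d div 2)"
proof -
  have "d = 2 * (d div 2) \<or> d = 2 * (d div 2) + 1"
    by presburger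
  then have "real d = 2 * real (d div 2) \<or> real d = 2 * real (d div 2) + 1"
    by (metis of_nat_1 of_nat_add of_nat_mult of_nat_numeral)
  then show ?thesis
    by (auto simp: ceiling_eq_iff)
qed

section \<open>The moment relaxation\<close>

lemma pairing_vec_family_sum:
  assumes "\<And>l. l \<in> {1..m} \<Longrightarrow> y l \<in> carrier_vec n"
  shows "pairing g (vec_family_sum n m y) = (\<Sum>l = 1..m. pairing g (y l))"
proof -
  have "pairing g (vec_family_sum n m y) = (\<Sum>i<n. \<Sum>l = 1..m. coeff g i * y l $ i)"
    by (simp add: pairing_def vec_family_sum_def sum_distrib_left)
  also have "\<dots> = (\<Sum>l = 1..m. \<Sum>i<n. coeff g i * y l $ i)"
    by (rule sum.swap)
  also have "\<dots> = (\<Sum>l = 1..m. pairing g (y l))"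
  proof (intro sum.cong refl)
    show "(\<Sum>i<n. coeff g i * y l $ i) = pairing g (y l)" if "l \<in> {1..m}" for l
      using carrier_vecD[OF assms[OF that]] by (simp add: pairing_def)
  qed
  finally show ?thesis .
qed

text \<open>
  Weak duality: by the Markov--Lukacs theorem each block is nonnegative on polynomials that are
  nonnegative on its interval, so the sum of the blocks is a functional that is nonnegative on
  polynomials that are nonnegative on the whole union.
\<close>

lemma mom_feasible_vec_family_sum:
  fixes m d :: nat and y :: "nat \<Rightarrow> real vec"
  defines "z \<equiv> vec_family_sum (d + 1) m y"
  assumes ab: "\<And>l. l \<in> {1..m} \<Longrightarrow> a l < b l" and y: "mom_feasible m a b d y"
  shows "mom_objective f m y = pairing f z"
    and "z $ 0 = 1"
    and "degree h \<le> d \<Longrightarrow> (\<And>x. x \<in> intervals_union m a b \<Longrightarrow> 0 \<le> poly h x) \<Longrightarrow> 0 \<le> pairing h z"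
proof -
  have blocks: "interval_moments (a l) (b l) d (y l)" if "l \<in> {1..m}" for l
    using y that unfolding mom_feasible_iff by blast
  then have pairing_z: "pairing g z = (\<Sum>l = 1..m. pairing g (y l))" for g
    unfolding z_def by (intro pairing_vec_family_sum) (simp add: interval_moments_def)
  show "mom_objective f m y = pairing f z"
    by (simp add: mom_objective_def pairing_z)
  show "z $ 0 = 1"
    using y unfolding mom_feasible_iff by (simp add: z_def vec_family_sum_def)
  assume h: "degree h \<le> d" "\<And>x. x \<in> intervals_union m a b \<Longrightarrow> 0 \<le> poly h x"
  have "0 \<le> pairing h (y l)" if l: "l \<in> {1..m}" for l
  proof (rule interval_moments_pairing_nonneg[OF blocks[OF l]])
    show "interval_cert (a l) (b l) d h"
      using l h(1) by (intro interval_cert_if_nonneg ab h(2) mem_intervals_unionI)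
  qed
  then show "0 \<le> pairing h z"
    unfolding pairing_z by (rule sum_nonneg)
qed

text \<open>
  The point evaluation at \<open>x\<close> is put into one block whose interval contains \<open>x\<close>. The other
  blocks are \<open>0\<close>, since the normalization counts the total mass.
\<close>

lemma mom_feasible_point:
  assumes "x \<in> intervals_union m a b" and "degree f \<le> d"
  shows "\<exists>y. mom_feasible m a b d y \<and> mom_objective f m y = poly f x"
proof -
  obtain k where k: "k \<in> {1..m}" "x \<in> {a k..b k}"
    using assms(1) by (auto simp: intervals_union_def)
  let ?v = "Matrix.vec (d + 1) (\<lambda>i. x ^ i)"
  define y where "y = (\<lambda>l. if l = k then ?v else 0\<^sub>v (d + 1))"
  have "interval_moments (a l) (b l) d (y l)" for l
    using interval_moments_point[OF k(2)] interval_moments_zero by (simp add: y_def)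
  moreover have "y l $ 0 = (if l = k then 1 else 0)" for l
    by (simp add: y_def)
  then have "(\<Sum>l = 1..m. y l $ 0) = 1"
    using k(1) by simp
  moreover have "pairing f (y l) = (if l = k then poly f x else 0)" for l
    using assms(2) pairing_point_moments[of f "d + 1" x] by (simp add: y_def pairing_def)
  then have "mom_objective f m y = poly f x"
    using k(1) by (simp add: mom_objective_def)
  ultimately show ?thesis
    unfolding mom_feasible_iff by blast
qed

theorem theorem4p6:
  fixes f :: "real poly" and m d :: nat and a b :: "nat \<Rightarrow> real" and K :: "real set"
  assumes "degree f = d"
    and "1 \<le> m"
    and "\<forall>l \<in> {1..m}. a l < b l"
    and "K = intervals_union m a b"
  shows
    "(\<exists>x \<in> K. ereal (poly f x) = f_min f m a b) \<and>
     (\<exists>\<gamma> X Y. sos_feasible f m a b d \<gamma> X Y \<and> ereal \<gamma> = f_sos f m a b d) \<and>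
     (\<exists>y. mom_feasible m a b d y \<and> ereal (mom_objective f m y) = f_mom f m a b d) \<and>
     f_min f m a b = f_sos f m a b d \<and>
     f_sos f m a b d = f_mom f m a b d \<and>
     ((\<nexists>c. f = [:c:]) \<longrightarrow>
        finite (minimizers f K) \<and>
        int (card (minimizers f K)) \<le> 2 * int m + \<lceil>(real d - 1) / 2\<rceil>) \<and>
     (\<forall>y z. is_arg_min (mom_objective f m) (mom_feasible m a b d) y \<and>
            z = vec_family_sum (d + 1) m y \<longrightarrow>
        (\<exists>\<mu>. representing_measure \<mu> z \<and> measure_support \<mu> \<subseteq> K) \<and>
        (\<forall>\<mu>. representing_measure \<mu> z \<and> measure_support \<mu> \<subseteq> K \<longrightarrow>
           measure_support \<mu> \<subseteq> minimizers f K \<and>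
           ((\<nexists>c. f = [:c:]) \<longrightarrow>
              (\<exists>r. atomic_measure r \<mu> \<and> int r \<le> 2 * int m + \<lceil>(real d - 1) / 2\<rceil>))))"
proof -
  have ab: "a l < b l" if "l \<in> {1..m}" for l
    using assms(3) that by blast
  have K: "compact K" "K \<noteq> {}"
    using assms(2) ab[of 1] unfolding assms(4) intervals_union_def
    by (auto intro!: compact_UN bexI[of _ 1])
  then obtain x0 where x0: "x0 \<in> K" "\<And>x. x \<in> K \<Longrightarrow> poly f x0 \<le> poly f x"
    using poly_attains_min[OF K, of f] by blast
  define v where "v = poly f x0"
  define p where "p = f - [:v:]"
  have p: "degree p \<le> d" "\<And>x. x \<in> K \<Longrightarrow> 0 \<le> poly p x"
    using x0(2) assms(1) by (auto simp: p_def v_def intro: degree_diff_le)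
  have p_nonzero: "p \<noteq> 0" if "\<nexists>c. f = [:c:]"
    using that by (auto simp: p_def)
  have minimizers: "minimizers f K = {x \<in> K. poly p x = 0}"
    using x0 by (force simp: minimizers_def is_arg_min_def p_def v_def)

  have f_min: "f_min f m a b = ereal v"
    unfolding f_min_def using x0 assms(4)
    by (intro antisym INF_lower2[of x0] INF_greatest) (simp_all add: v_def)

  obtain X Y where XY: "sos_feasible f m a b d v X Y"
  proof -
    have "interval_cert (a l) (b l) d (f - [:v:])" if "l \<in> {1..m}" for l
      unfolding p_def[symmetric] using that p(1)
      by (intro interval_cert_if_nonneg ab p(2)) (auto simp only: assms(4) intro: mem_intervals_unionI)
    then show ?thesis
      using sos_feasible_if_certs that by metis
  qed
  have sos_bound: "\<gamma> \<le> v" if "sos_feasible f m a b d \<gamma> X Y" for \<gamma> X Y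
    using sos_feasible_lower_bound[OF that] x0(1) by (auto simp: assms(4) intervals_union_def v_def)
  have f_sos: "f_sos f m a b d = ereal v"
    unfolding f_sos_def
    by (intro antisym Sup_least Sup_upper) (use XY sos_bound in auto)

  \<comment> \<open>The total mass is \<open>1\<close>, so the functional \<open>z\<close> evaluates \<open>f - v\<close> to the gap between the
      objective and \<open>v\<close>.\<close>
  have mom_value: "pairing p (vec_family_sum (d + 1) m y) = mom_objective f m y - v"
    if "mom_feasible m a b d y" for y
    using mom_feasible_vec_family_sum(1,2)[OF ab that]
    by (simp add: p_def pairing_diff pairing_const vec_family_sum_def)
  have mom_bound: "v \<le> mom_objective f m y" if "mom_feasible m a b d y" for y
    using mom_feasible_vec_family_sum(3)[OF ab that p(1)] p(2) mom_value[OF that]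
    by (simp add: assms(4))
  obtain y0 where y0: "mom_feasible m a b d y0" "mom_objective f m y0 = v"
    using mom_feasible_point[of x0 m a b f d] x0(1) assms(1,4) by (auto simp: v_def)
  have f_mom: "f_mom f m a b d = ereal v"
    unfolding f_mom_def using y0 mom_bound
    by (intro antisym INF_lower2[of y0] INF_greatest) simp_all

  have card_minimizers: "finite (minimizers f K)"
      "int (card (minimizers f K)) \<le> 2 * int m + \<lceil>(real d - 1) / 2\<rceil>"
    if nonconst: "\<nexists>c. f = [:c:]"
  proof -
    show "finite (minimizers f K)"
      unfolding minimizers using poly_roots_finite[OF p_nonzero[OF nonconst]] by simp
    have "card (minimizers f K) \<le> 2 * m + degree p div 2"
      unfolding minimizers unfolding assms(4)
      by (rule card_zeros_of_nonneg[OF p_nonzero[OF nonconst]]) (use p(2) assms(4) in blast)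
    also have "\<dots> \<le> 2 * m + d div 2"
      using p(1) by (simp add: div_le_mono)
    finally show "int (card (minimizers f K)) \<le> 2 * int m + \<lceil>(real d - 1) / 2\<rceil>"
      unfolding ceiling_half_pred by linarith
  qed

  have measures: "(\<exists>\<mu>. representing_measure \<mu> z \<and> measure_support \<mu> \<subseteq> K) \<and>
      (\<forall>\<mu>. representing_measure \<mu> z \<and> measure_support \<mu> \<subseteq> K \<longrightarrow>
         measure_support \<mu> \<subseteq> minimizers f K \<and>
         ((\<nexists>c. f = [:c:]) \<longrightarrow>
            (\<exists>r. atomic_measure r \<mu> \<and> int r \<le> 2 * int m + \<lceil>(real d - 1) / 2\<rceil>)))"
    if opt: "is_arg_min (mom_objective f m) (mom_feasible m a b d) y"
      and z: "z = vec_family_sum (d + 1) m y" for y z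
  proof -
    have y: "mom_feasible m a b d y"
      using opt by (simp add: is_arg_min_def)
    have "mom_objective f m y \<le> v"
      using opt y0 by (auto simp: is_arg_min_def not_less)
    then have pz: "pairing p z = 0"
      using mom_value[OF y] mom_bound[OF y] by (simp add: z)
    have dim: "dim_vec z = d + 1"
      by (simp add: z vec_family_sum_def)
    have z0: "z $ 0 = 1"
      unfolding z by (rule mom_feasible_vec_family_sum(2)[OF ab y])
    have pos: "0 \<le> pairing h z" if "degree h \<le> d" "\<And>x. x \<in> K \<Longrightarrow> 0 \<le> poly h x" for h
      using mom_feasible_vec_family_sum(3)[OF ab y that(1)] that(2) by (simp add: z assms(4))
    have ex: "\<exists>\<mu>. representing_measure \<mu> z \<and> measure_support \<mu> \<subseteq> K"
    proof (cases "p = 0")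
      case True
      \<comment> \<open>Here \<open>f\<close> is constant, so \<open>z = (1)\<close> and every unit point mass in \<open>K\<close> represents it.\<close>
      then have "d = 0"
        using assms(1) by (auto simp: p_def)
      then have "\<exists>\<mu>. representing_measure \<mu> z \<and> measure_support \<mu> \<subseteq> {x0}"
        using dim z0 by (intro atomic_representing_measure[where c = "\<lambda>_. 1"]) auto
      then show ?thesis
        using x0(1) by blast
    next
      case False
      let ?Z = "{x \<in> K. poly p x = 0}"
      obtain c where c: "\<forall>t \<in> ?Z. 0 \<le> c t"
          "\<And>g. degree g \<le> d \<Longrightarrow> pairing g z = (\<Sum>t \<in> ?Z. c t * poly g t)"
        using pairing_eq_sum_over_zeros[OF K(1) pos p pz False] by blast
      have "z $ i = (\<Sum>t \<in> ?Z. c t * t ^ i)" if "i < dim_vec z" for i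
      proof -
        have "degree (monom (1 :: real) i) \<le> d"
          using that dim by (simp add: degree_monom_eq)
        from c(2)[OF this] show ?thesis
          using that by (simp add: pairing_monom poly_monom)
      qed
      then have "\<exists>\<mu>. representing_measure \<mu> z \<and> measure_support \<mu> \<subseteq> ?Z"
        using c(1) poly_roots_finite[OF False] by (intro atomic_representing_measure) auto
      then show ?thesis
        by blast
    qed
    have support: "measure_support \<mu> \<subseteq> minimizers f K"
      if "representing_measure \<mu> z" "measure_support \<mu> \<subseteq> K" for \<mu>
      unfolding minimizers using K(1) p pz dim
      by (intro measure_support_subset_zeros[OF that]) (auto intro: compact_imp_closed)
    have "\<exists>r. atomic_measure r \<mu> \<and> int r \<le> 2 * int m + \<lceil>(real d - 1) / 2\<rceil>"
      if "representing_measure \<mu> z" "measure_support \<mu> \<subseteq> K" and nonconst: "\<nexists>c. f = [:c:]" for \<mu>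
    proof -
      note card_minimizers = card_minimizers[OF nonconst]
      have "finite (measure_support \<mu>)" "card (measure_support \<mu>) \<le> card (minimizers f K)"
        using finite_subset[OF support[OF that(1,2)]] card_mono[OF _ support[OF that(1,2)]]
          card_minimizers(1) by blast+
      then show ?thesis
        using card_minimizers(2) unfolding atomic_measure_def
        by (intro exI[of _ "card (measure_support \<mu>)"]) linarith
    qed
    then show ?thesis
      using ex support by blast
  qed
  show ?thesis
    unfolding f_min f_sos f_mom
  proof (intro conjI)
    show "\<exists>x \<in> K. ereal (poly f x) = ereal v"
      using x0(1) v_def by blast
    show "\<exists>\<gamma> X Y. sos_feasible f m a b d \<gamma> X Y \<and> ereal \<gamma> = ereal v"
      using XY by blast
    show "\<exists>y. mom_feasible m a b d y \<and> ereal (mom_objective f m y) = ereal v"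
      using y0 by blast
  qed (use card_minimizers measures in blast)+
qed

end
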